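(* The vertices $0,17,18,5,6,23,22,1$, in this cyclic order, form an $8$-cycle of the graph $\mathrm{TC}$ whose edges alternate between chords and outer edges. Consequently the graph $G_{450}$, obtained from $\mathrm{TC}$ by replacing every vertex by the gadget $H_{15}$ with the attachment $u$ facing the chord at that vertex, contains a $32$-cycle.
   Context: Graphs are finite, simple and undirected; cycles are simple. $\mathrm{TC}$ (the Tutte–Coxeter graph) is the cubic graph with vertex set $\{0,1,\dots,29\}$ whose edges are the outer edges $\{i,i+1\}$ for $i=0,\dots,29$ (indices mod $30$; they form a Hamiltonian cycle) and the fifteen chords $\{29+6t,12+6t\}$, $\{28+6t,7+6t\}$, $\{26+6t,3+6t\}$ for $t=0,\dots,4$ (indices mod $30$). Gadgets: $H_7$ is the graph with vertices $u,v,w,a,b,c,d$ and edges $va,ab,bw,cv,wd,ac,cu,ud,db$. $H_{15}$ consists of two disjoint copies $A,B$ of $H_7$ (with vertices subscripted by $A$ or $B$) and one further vertex $z$, with the additional edges $v_Av_B$, $w_Az$, $zw_B$; its three attachments (its vertices of degree $2$) are named $u=z$, $v=u_B$, $w=u_A$. Replacing every vertex of a cubic graph by $H_{15}$: take disjoint copies of $H_{15}$, one for each vertex $x$; for each $x$ choose a bijection between the three edges at $x$ and the three attachments of its copy (an edge is said to face the attachment it is assigned to); for each edge $xy$ add an edge joining the attachment of the copy of $x$ facing $xy$ to the attachment of the copy of $y$ facing $xy$. In $G_{450}$ the attachment $u$ of each copy faces the unique chord at the vertex; the other two edges at the vertex are assigned to $v$ and $w$ in either order (all choices give isomorphic graphs,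 as $H_{15}$ has an automorphism fixing $u$ and exchanging $v$ and $w$). *)

theory Defs
  imports "Graph_Theory.Graph_Theory"
begin

text \<open>
  An undirected graph is a symmetric loop-free \<^typ>\<open>'a pair_pre_digraph\<close> (locale
  \<^locale>\<open>pair_graph\<close>): every edge \<open>xy\<close> is represented by the two arcs \<open>(x,y)\<close> and \<open>(y,x)\<close>.
  Hence the edges at a vertex \<open>x\<close> correspond to the arcs \<open>(x,y)\<close> with tail \<open>x\<close>, that is,
  to \<^term>\<open>out_arcs G x\<close>.  For these graphs, an \<open>n\<close>-cycle with \<open>n \<ge> 3\<close> is an arc list of
  length \<open>n\<close> satisfying the library predicate \<^const>\<open>pre_digraph.cycle\<close> (closed walk without
  repeated vertices).
\<close>

definition both_ways :: "'a rel \<Rightarrow> 'a rel" where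
  "both_ways r = r \<union> r\<inverse>"

text \<open>The arcs \<open>(x\<^sub>0,x\<^sub>1), (x\<^sub>1,x\<^sub>2), \<dots>, (x\<^sub>k,x\<^sub>0)\<close> for a cyclic sequence of vertices.\<close>

definition cyclic_arcs :: "'a list \<Rightarrow> ('a \<times> 'a) list" where
  "cyclic_arcs xs = zip xs (rotate1 xs)"

text \<open>Cyclic alternation, including the last and the first entry; meant for disjoint \<open>A\<close>, \<open>B\<close>.\<close>

definition alternates_cyclically :: "'e set \<Rightarrow> 'e set \<Rightarrow> 'e list \<Rightarrow> bool" where
  "alternates_cyclically A B es \<longleftrightarrow>
     (\<forall>i < length es. let e = es ! i; e' = es ! (Suc i mod length es) in
        e \<in> A \<and> e' \<in> B \<or> e \<in> B \<and> e' \<in> A)"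


section \<open>The Tutte--Coxeter graph\<close>

definition TC_outer :: "nat rel" where
  "TC_outer = both_ways {(i, (i + 1) mod 30) | i. i < 30}"

definition TC_chords :: "nat rel" where
  "TC_chords = both_ways
     ({((29 + 6 * t) mod 30, (12 + 6 * t) mod 30) | t. t < 5} \<union>
      {((28 + 6 * t) mod 30, (7 + 6 * t) mod 30) | t. t < 5} \<union>
      {((26 + 6 * t) mod 30, (3 + 6 * t) mod 30) | t. t < 5})"

definition TC :: "nat pair_pre_digraph" where
  "TC = \<lparr> pverts = {0..<30}, parcs = TC_outer \<union> TC_chords \<rparr>"


section \<open>The gadgets\<close>

datatype h7 = H7_u | H7_v | H7_w | H7_a | H7_b | H7_c | H7_d

definition H7 :: "h7 pair_pre_digraph" where
  "H7 = \<lparr> pverts = UNIV,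
     parcs = both_ways {(H7_v, H7_a), (H7_a, H7_b), (H7_b, H7_w), (H7_c, H7_v), (H7_w, H7_d),
                        (H7_a, H7_c), (H7_c, H7_u), (H7_u, H7_d), (H7_d, H7_b)} \<rparr>"

datatype h15 = CopyA h7 | CopyB h7 | H15_z

definition H15 :: "h15 pair_pre_digraph" where
  "H15 = \<lparr> pverts = UNIV,
     parcs = map_prod CopyA CopyA ` parcs H7 \<union> map_prod CopyB CopyB ` parcs H7 \<union>
       both_ways {(CopyA H7_v, CopyB H7_v), (CopyA H7_w, H15_z), (H15_z, CopyB H7_w)} \<rparr>"

definition H15_u :: h15 where "H15_u = H15_z"
definition H15_v :: h15 where "H15_v = CopyB H7_u"
definition H15_w :: h15 where "H15_w = CopyA H7_u"

definition H15_attachments :: "h15 set" where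
  "H15_attachments = {H15_u, H15_v, H15_w}"


section \<open>Replacing the vertices of a cubic graph by H15\<close>

text \<open>
  The value of \<open>\<phi>\<close> at an arc \<open>(x,y)\<close> is the attachment of the copy of \<open>x\<close> faced by the edge
  \<open>xy\<close>; the attachment of the copy of \<open>y\<close> faced by the same edge is its value at \<open>(y,x)\<close>.
\<close>

definition facing :: "'a pair_pre_digraph \<Rightarrow> ('a \<times> 'a \<Rightarrow> h15) \<Rightarrow> bool" where
  "facing G \<phi> \<longleftrightarrow>
     (\<forall>x \<in> pverts G. bij_betw \<phi> (out_arcs (with_proj G) x) H15_attachments)"

definition replace_by_H15 ::
    "'a pair_pre_digraph \<Rightarrow> ('a \<times> 'a \<Rightarrow> h15) \<Rightarrow> ('a \<times> h15) pair_pre_digraph" where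
  "replace_by_H15 G \<phi> = \<lparr> pverts = pverts G \<times> pverts H15,
     parcs = {((x, p), (x, q)) | x p q. x \<in> pverts G \<and> (p, q) \<in> parcs H15} \<union>
             {((x, \<phi> (x, y)), (y, \<phi> (y, x))) | x y. (x, y) \<in> parcs G} \<rparr>"

text \<open>
  The predicate covers all choices of which of the two outer edges at a vertex faces \<open>v\<close> and
  which faces \<open>w\<close>.
\<close>

definition is_G450 :: "(nat \<times> h15) pair_pre_digraph \<Rightarrow> bool" where
  "is_G450 \<Gamma> \<longleftrightarrow>
     (\<exists>\<phi>. facing TC \<phi> \<and> (\<forall>e \<in> TC_chords. \<phi> e = H15_u) \<and> \<Gamma> = replace_by_H15 TC \<phi>)"


section \<open>Basic facts\<close>

lemma both_ways_empty: "both_ways {} = {}"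
  by (simp add: both_ways_def)

lemma both_ways_insert: "both_ways (insert (a, b) r) = insert (a, b) (insert (b, a) (both_ways r))"
  by (auto simp: both_ways_def)

lemma sym_both_ways: "sym (both_ways r)"
  by (auto simp: both_ways_def sym_def)

lemma less_5_cases: "(t::nat) < 5 \<longleftrightarrow> t = 0 \<or> t = 1 \<or> t = 2 \<or> t = 3 \<or> t = 4"
  by auto

lemma mod_30_next: "x < 30 \<Longrightarrow> (x + 1) mod 30 = (if x = 29 then 0 else x + 1)" for x :: nat
  by auto

lemma mod_30_prev: "x < 30 \<Longrightarrow> (x + 29) mod 30 = (if x = 0 then 29 else x - 1)" for x :: nat
  using mod_add_self2[of "x - 1" 30] by (cases x) simp_all

lemma TC_outer_iff:
  "(x, y) \<in> TC_outer \<longleftrightarrow> x < 30 \<and> y < 30 \<and> (y = (x + 1) mod 30 \<or> x = (y + 1) mod 30)"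
  by (auto simp: TC_outer_def both_ways_def)

lemma TC_chords_eq: "TC_chords = both_ways
    {(26, 3), (2, 9), (8, 15), (14, 21), (20, 27),
     (28, 7), (4, 13), (10, 19), (16, 25), (22, 1),
     (29, 12), (5, 18), (11, 24), (17, 0), (23, 6)}"
proof -
  have eq: "{f t | t. t < 5} = {f 0, f 1, f 2, f 3, f 4}" for f :: "nat \<Rightarrow> nat \<times> nat"
    unfolding less_5_cases by auto
  show ?thesis
    unfolding TC_chords_def eq by (rule arg_cong[of _ _ both_ways]) simp
qed

lemma TC_chord_props:
  assumes "(x, y) \<in> TC_chords"
  shows "x < 30" "y < 30" "x \<noteq> y" "(x, y) \<notin> TC_outer" "(y, x) \<in> TC_chords"
proof -
  have "\<forall>(x, y) \<in> TC_chords. x < 30 \<and> y < 30 \<and> x \<noteq> y \<and> (x, y) \<notin> TC_outer"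
    by (simp add: TC_chords_eq both_ways_insert both_ways_empty TC_outer_iff)
  with assms show "x < 30" "y < 30" "x \<noteq> y" "(x, y) \<notin> TC_outer" by auto
  show "(y, x) \<in> TC_chords" using assms by (auto simp: TC_chords_def both_ways_def)
qed

lemma TC_outer_chords_disjoint: "TC_outer \<inter> TC_chords = {}"
  using TC_chord_props(4) by auto

lemma TC_chord_unique:
  assumes "x < 30" shows "\<exists>!y. (x, y) \<in> TC_chords"
proof -
  have unique: "y = y'" if "(x, y) \<in> TC_chords" "(x, y') \<in> TC_chords" for x y y'
  proof -
    have "\<forall>(x, y) \<in> TC_chords. \<forall>(x', y') \<in> TC_chords. x = x' \<longrightarrow> y = y'"
      by (simp add: TC_chords_eq both_ways_insert both_ways_empty)
    with that show ?thesis by blast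
  qed
  then have "inj_on fst TC_chords"
    by (auto simp: inj_on_def)
  moreover have "card TC_chords = 30"
    by (simp add: TC_chords_eq both_ways_insert both_ways_empty)
  ultimately have "card (fst ` TC_chords) = card {0..<30::nat}"
    by (simp add: card_image)
  moreover have "fst ` TC_chords \<subseteq> {0..<30}"
    using TC_chord_props(1) by auto
  ultimately have "fst ` TC_chords = {0..<30}"
    by (metis card_subset_eq finite_atLeastLessThan)
  then have "x \<in> fst ` TC_chords" using assms by simp
  with unique show ?thesis by force
qed

lemma pair_graph_TC: "pair_graph TC"
proof -
  have arcs: "x < 30 \<and> y < 30 \<and> x \<noteq> y \<and> (y, x) \<in> parcs TC" if "(x, y) \<in> parcs TC" for x y
    using that
  proof (cases "(x, y) \<in> TC_chords")
    case True
    then show ?thesis using TC_chord_props[of x y] by (simp add: TC_def)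
  next
    case False
    then have "(x, y) \<in> TC_outer" using that by (simp add: TC_def)
    moreover have "z \<noteq> (z + 1) mod 30" if "z < 30" for z :: nat
      using that by (simp only: mod_30_next split: if_split) simp
    ultimately show ?thesis unfolding TC_def TC_outer_iff pair_pre_digraph.simps
      by (metis UnI1 TC_outer_iff)
  qed
  then have "parcs TC \<subseteq> {0..<30} \<times> {0..<30}" by auto
  then have "finite (parcs TC)" by (rule finite_subset) simp
  moreover have "pverts TC = {0..<30}" by (simp add: TC_def)
  ultimately show ?thesis
    by unfold_locales (auto simp: symmetric_def intro!: symI dest: arcs)
qed

lemma TC_out_arcs:
  assumes "x < 30" "(x, c) \<in> TC_chords"
  shows "out_arcs (with_proj TC) x = {(x, c), (x, (x + 1) mod 30), (x, (x + 29) mod 30)}"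
    and "c \<noteq> (x + 1) mod 30" "c \<noteq> (x + 29) mod 30" "(x + 1) mod 30 \<noteq> (x + 29) mod 30"
proof -
  have outer: "(x, y) \<in> TC_outer \<longleftrightarrow> y = (x + 1) mod 30 \<or> y = (x + 29) mod 30" for y
  proof (cases "y < 30")
    case True
    then show ?thesis using assms(1)
      unfolding TC_outer_iff by (auto simp only: mod_30_next mod_30_prev split: if_splits)
  next
    case False
    then show ?thesis by (auto simp: TC_outer_iff)
  qed
  have chord: "(x, y) \<in> TC_chords \<longleftrightarrow> y = c" for y
    using TC_chord_unique[OF assms(1)] assms(2) by auto
  show "out_arcs (with_proj TC) x = {(x, c), (x, (x + 1) mod 30), (x, (x + 29) mod 30)}"
    using outer chord by (auto simp: out_arcs_def TC_def)
  show "c \<noteq> (x + 1) mod 30" "c \<noteq> (x + 29) mod 30"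
    using outer TC_chord_props(4)[OF assms(2)] by auto
  show "(x + 1) mod 30 \<noteq> (x + 29) mod 30"
    using assms(1) by (auto simp only: mod_30_next mod_30_prev split: if_splits)
qed

lemma TC_cubic:
  assumes "x \<in> pverts TC" shows "out_degree (with_proj TC) x = 3"
proof -
  have "x < 30" using assms by (simp add: TC_def)
  moreover obtain c where "(x, c) \<in> TC_chords" using TC_chord_unique[OF \<open>x < 30\<close>] by auto
  ultimately show ?thesis
    using TC_out_arcs[of x c] by (simp add: out_degree_def)
qed

lemma pverts_H15: "pverts H15 =
   {CopyA H7_u, CopyA H7_v, CopyA H7_w, CopyA H7_a, CopyA H7_b, CopyA H7_c, CopyA H7_d,
    CopyB H7_u, CopyB H7_v, CopyB H7_w, CopyB H7_a, CopyB H7_b, CopyB H7_c, CopyB H7_d, H15_z}"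
proof -
  have "p \<in> {CopyA H7_u, CopyA H7_v, CopyA H7_w, CopyA H7_a, CopyA H7_b, CopyA H7_c, CopyA H7_d,
     CopyB H7_u, CopyB H7_v, CopyB H7_w, CopyB H7_a, CopyB H7_b, CopyB H7_c, CopyB H7_d, H15_z}" for p
  proof (cases p)
    case (CopyA q) then show ?thesis by (cases q) auto
  next
    case (CopyB q) then show ?thesis by (cases q) auto
  qed simp
  then show ?thesis by (auto simp: H15_def)
qed

lemma finite_h15: "finite (UNIV :: h15 set)"
proof -
  have "finite (pverts H15)" unfolding pverts_H15 by simp
  then show ?thesis by (simp add: H15_def)
qed

lemma pair_graph_H15: "pair_graph H15"
proof -
  have "finite (parcs H15)"
    by (rule finite_subset[OF subset_UNIV]) (simp add: finite_Prod_UNIV finite_h15)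
  moreover have "\<forall>e \<in> parcs H15. fst e \<noteq> snd e"
    by (simp add: H15_def H7_def both_ways_insert both_ways_empty)
  moreover have "sym (parcs H15)"
  proof -
    have "sym (map_prod f f ` r)" if "sym r" for f :: "h7 \<Rightarrow> h15" and r
      using that by (auto simp: sym_def map_prod_def image_iff) (metis case_prod_conv)
    then show ?thesis by (simp add: H15_def H7_def sym_Un sym_both_ways)
  qed
  moreover have "pverts H15 = UNIV" by (simp add: H15_def)
  ultimately show ?thesis
    using finite_h15 by unfold_locales (simp_all add: symmetric_def)
qed

text \<open>The attachments are exactly the vertices of degree 2.\<close>

lemma H15_degrees:
  "out_degree (with_proj H15) p = (if p \<in> H15_attachments then 2 else 3)"
proof -
  have "out_arcs (with_proj H15) p = Pair p ` {q. (p, q) \<in> parcs H15}"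
    by (auto simp: out_arcs_def)
  then have deg: "out_degree (with_proj H15) p = card {q. (p, q) \<in> parcs H15}"
    by (simp add: out_degree_def card_image inj_on_def)
  have nbs: "{q. (p, q) \<in> parcs H15} = (case p of
      H15_z \<Rightarrow> {CopyA H7_w, CopyB H7_w}
    | CopyA r \<Rightarrow> CopyA ` {s. (r, s) \<in> parcs H7} \<union>
        (if r = H7_v then {CopyB H7_v} else if r = H7_w then {H15_z} else {})
    | CopyB r \<Rightarrow> CopyB ` {s. (r, s) \<in> parcs H7} \<union>
        (if r = H7_v then {CopyA H7_v} else if r = H7_w then {H15_z} else {}))"
    by (cases p) (auto simp: H15_def both_ways_insert both_ways_empty)
  have nbs7: "{s. (r, s) \<in> parcs H7} = (case r of
      H7_u \<Rightarrow> {H7_c, H7_d} | H7_v \<Rightarrow> {H7_a, H7_c} | H7_w \<Rightarrow> {H7_b, H7_d}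
    | H7_a \<Rightarrow> {H7_v, H7_b, H7_c} | H7_b \<Rightarrow> {H7_a, H7_w, H7_d}
    | H7_c \<Rightarrow> {H7_v, H7_a, H7_u} | H7_d \<Rightarrow> {H7_w, H7_u, H7_b})" for r
    by (cases r) (auto simp: H7_def both_ways_insert both_ways_empty)
  show ?thesis
    unfolding deg nbs nbs7
    by (simp add: H15_attachments_def H15_u_def H15_v_def H15_w_def split: h15.split h7.split)
qed

lemma ex_G450: "\<exists>\<Gamma>. is_G450 \<Gamma>"
proof -
  define \<phi> :: "nat \<times> nat \<Rightarrow> h15" where
    "\<phi> = (\<lambda>e. if e \<in> TC_chords then H15_u else if snd e = (fst e + 1) mod 30 then H15_v else H15_w)"
  have "bij_betw \<phi> (out_arcs (with_proj TC) x) H15_attachments" if "x \<in> pverts TC" for x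
  proof -
    have "x < 30" using that by (simp add: TC_def)
    moreover obtain c where c: "(x, c) \<in> TC_chords" using TC_chord_unique[OF \<open>x < 30\<close>] by auto
    ultimately have "\<phi> (x, c) = H15_u \<and> \<phi> (x, (x + 1) mod 30) = H15_v \<and> \<phi> (x, (x + 29) mod 30) = H15_w"
      using TC_out_arcs(2-)[of x c] TC_chord_unique[of x] by (auto simp: \<phi>_def)
    then show ?thesis
      using TC_out_arcs[OF \<open>x < 30\<close> c]
      by (simp add: bij_betw_def inj_on_def H15_attachments_def H15_u_def H15_v_def H15_w_def)
  qed
  then have "facing TC \<phi>"
    by (simp add: facing_def)
  moreover have "\<forall>e \<in> TC_chords. \<phi> e = H15_u"
    by (simp add: \<phi>_def)
  ultimately show ?thesis
    unfolding is_G450_def by blast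
qed

lemma card_G450: "is_G450 \<Gamma> \<Longrightarrow> card (pverts \<Gamma>) = 450"
  by (auto simp: is_G450_def replace_by_H15_def TC_def card_cartesian_product pverts_H15)

end

theory Submission
  imports Defs
begin

text \<open>
  Inside a copy of \<open>H\<^sub>1\<^sub>5\<close>, the attachment \<open>u = z\<close> is joined to \<open>v\<close> through copy \<open>B\<close> of \<open>H\<^sub>7\<close> and to
  \<open>w\<close> through copy \<open>A\<close>, in both cases by a path on four vertices.  The two edges of an alternating
  cycle of \<open>TC\<close> at a vertex \<open>x\<close> are one chord, facing \<open>u\<close>, and one outer edge, facing \<open>v\<close> or
  \<open>w\<close>; so whatever the choice, every vertex of the cycle can be expanded into four vertices.
\<close>

text \<open>For \<open>xs = x # ys\<close> the closed walk visits \<open>x # ys @ [x]\<close>. The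
  library predicate asks for distinctness of the tail of this list, which is a rotation of
  \<open>xs\<close>.\<close>

lemma cycle_cyclic_arcs:
  fixes G :: "'a pair_pre_digraph"
  assumes "distinct xs" "xs \<noteq> []" "hd xs \<in> pverts G" "set (cyclic_arcs xs) \<subseteq> parcs G"
  shows "pre_digraph.cycle (with_proj G) (cyclic_arcs xs)"
proof -
  obtain x ys where xs: "xs = x # ys"
    using assms(2) by (cases xs) auto
  \<comment> \<open>The two ends \<open>a\<close> and \<open>b\<close> are kept apart so that the
    induction can move \<open>a\<close>; the closed walk is the case
    \<open>a = b = x\<close>.\<close>
  have cas: "pcas a (zip (a # bs) (bs @ [b])) b" for a b :: 'a and bs
    by (induction bs arbitrary: a) auto
  have verts: "pawalk_verts a (zip (a # bs) (bs @ [b])) = a # bs @ [b]" for a b :: 'a and bs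
    by (induction bs arbitrary: a) auto
  have arcs: "cyclic_arcs xs = zip (x # ys) (ys @ [x])"
    by (simp add: cyclic_arcs_def xs)
  have "x \<in> pverts G" "distinct (ys @ [x])" "cyclic_arcs xs \<noteq> []"
    using assms by (auto simp: xs cyclic_arcs_def)
  moreover have "pcas x (cyclic_arcs xs) x" "pawalk_verts x (cyclic_arcs xs) = x # ys @ [x]"
    unfolding arcs by (rule cas verts)+
  ultimately show ?thesis
    using assms(4)
    unfolding pre_digraph.cycle_def pre_digraph.awalk_def cas_with_proj_eq awalk_verts_with_proj_eq
      with_proj_simps
    by (metis list.sel(3))
qed

abbreviation TC_cycle :: "nat list" where
  "TC_cycle \<equiv> [0, 17, 18, 5, 6, 23, 22, 1]"

lemma TC_chords_TC_cycle:
  "{(0, 17), (18, 5), (6, 23), (22, 1)} \<subseteq> TC_chords"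
  by (simp add: TC_chords_eq both_ways_insert)

text \<open>Both orientations are listed because the attachments at the two ends of an edge are read
  off from opposite arcs.\<close>

lemma TC_outer_TC_cycle:
  "{(17, 18), (5, 6), (23, 22), (1, 0)} \<union> {(18, 17), (6, 5), (22, 23), (0, 1)} \<subseteq> TC_outer"
  by (simp add: TC_outer_iff)

lemma cycle_TC_cycle: "pre_digraph.cycle (with_proj TC) (cyclic_arcs TC_cycle)"
  using TC_chords_TC_cycle TC_outer_TC_cycle
  by (intro cycle_cyclic_arcs) (simp_all add: cyclic_arcs_def TC_def)

lemma alternates_TC_cycle: "alternates_cyclically TC_chords TC_outer (cyclic_arcs TC_cycle)"
proof -
  have all_less_8: "\<forall>i < (8::nat). P i" if "P 0" "P 1" "P 2" "P 3" "P 4" "P 5" "P 6" "P 7" for P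
    using that by (simp add: numeral_eq_Suc All_less_Suc)
  have "length (cyclic_arcs TC_cycle) = 8"
    by (simp add: cyclic_arcs_def)
  then show ?thesis
    using TC_chords_TC_cycle TC_outer_TC_cycle
    unfolding alternates_cyclically_def Let_def
    by (simp only:, intro all_less_8) (simp_all add: cyclic_arcs_def)
qed

text \<open>\<open>\<phi>\<close> is injective on the arcs at \<open>x\<close> and the chord already
  takes \<open>H15_u\<close>, so only \<open>H15_v\<close> and \<open>H15_w\<close> remain; these
  are the \<open>H7_u\<close> of copies \<open>B\<close> and \<open>A\<close>.\<close>

lemma facing_outer:
  assumes "facing TC \<phi>" "\<forall>e \<in> TC_chords. \<phi> e = H15_u" "(x, y) \<in> TC_outer"
  shows "\<exists>C \<in> {CopyA, CopyB}. \<phi> (x, y) = C H7_u"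
proof -
  have x: "x \<in> pverts TC" "x < 30"
    using assms(3) by (auto simp: TC_outer_iff TC_def)
  obtain c where c: "(x, c) \<in> TC_chords"
    using TC_chord_unique[OF x(2)] by auto
  have bij: "bij_betw \<phi> (out_arcs (with_proj TC) x) H15_attachments"
    using assms(1) x(1) by (simp add: facing_def)
  have arcs: "(x, c) \<in> out_arcs (with_proj TC) x" "(x, y) \<in> out_arcs (with_proj TC) x"
    using c assms(3) by (auto simp: TC_def)
  moreover have "(x, y) \<noteq> (x, c)"
    using c assms(3) TC_outer_chords_disjoint by auto
  ultimately have "\<phi> (x, y) \<noteq> \<phi> (x, c)"
    using bij by (auto simp: bij_betw_def dest: inj_onD)
  moreover have "\<phi> (x, y) \<in> H15_attachments"
    using bij arcs(2) by (auto simp: bij_betw_def)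
  ultimately show ?thesis
    using assms(2) c by (auto simp: H15_attachments_def H15_u_def H15_v_def H15_w_def)
qed

lemma parcs_H15_leg:
  assumes "C = CopyA \<or> C = CopyB"
  shows "{(H15_z, C H7_w), (C H7_w, C H7_d), (C H7_d, C H7_u)} \<union>
         {(C H7_w, H15_z), (C H7_d, C H7_w), (C H7_u, C H7_d)} \<subseteq> parcs H15"
proof -
  have "(H7_w, H7_d) \<in> parcs H7" "(H7_d, H7_w) \<in> parcs H7" "(H7_d, H7_u) \<in> parcs H7"
    "(H7_u, H7_d) \<in> parcs H7"
    by (simp_all add: H7_def both_ways_insert)
  then have "{(C H7_w, C H7_d), (C H7_d, C H7_w), (C H7_d, C H7_u), (C H7_u, C H7_d)}
      \<subseteq> map_prod C C ` parcs H7"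
    by (simp add: image_iff) force
  then show ?thesis
    using assms unfolding H15_def by (elim disjE) (simp_all add: both_ways_insert)
qed

lemma cycle_32_G450:
  assumes "is_G450 \<Gamma>"
  shows "\<exists>p. pre_digraph.cycle (with_proj \<Gamma>) p \<and> length p = 32"
proof -
  obtain \<phi> where \<phi>: "facing TC \<phi>" "\<forall>e \<in> TC_chords. \<phi> e = H15_u"
    and \<Gamma>: "\<Gamma> = replace_by_H15 TC \<phi>"
    using assms by (auto simp: is_G450_def)
  let ?steps = "[(17, 18), (5, 6), (23, 22), (1, 0)] :: (nat \<times> nat) list"
  \<comment> \<open>\<open>C e\<close> is the constructor of the copy of \<open>H7\<close> that
    contains the attachment faced by \<open>e\<close>; this keeps the argument uniform in the choice
    of \<open>\<phi>\<close>.\<close>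
  define C where "C e = (SOME K. K \<in> {CopyA, CopyB} \<and> \<phi> e = K H7_u)" for e
  have C: "C e \<in> {CopyA, CopyB} \<and> \<phi> e = C e H7_u" if "e \<in> TC_outer" for e
  proof -
    have "\<exists>K. K \<in> {CopyA, CopyB} \<and> \<phi> e = K H7_u"
      using facing_outer[OF \<phi>, of "fst e" "snd e"] that by auto
    then show ?thesis
      unfolding C_def by (rule someI_ex)
  qed
  define seg where "seg e = map (Pair (fst e)) [H15_z, C e H7_w, C e H7_d, C e H7_u]" for e :: "nat \<times> nat"
  \<comment> \<open>Each outer step enters the copy of \<open>x\<close> at \<open>H15_z\<close>,
    leaves it through the attachment facing \<open>y\<close>, and runs back to \<open>H15_z\<close>
    in the copy of \<open>y\<close>: 8 vertices for each of 4 steps.\<close>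
  define xs where "xs = concat (map (\<lambda>(x, y). seg (x, y) @ rev (seg (y, x))) ?steps)"
  have C_neq: "distinct [H15_z, C e H7_w, C e H7_d, C e H7_u]" if "e \<in> TC_outer" for e
    using C[OF that] by auto
  have inner: "((x, p), (x, q)) \<in> parcs \<Gamma>" if "x < 30" "(p, q) \<in> parcs H15" for x p q
    using that by (auto simp: \<Gamma> replace_by_H15_def TC_def)
  have leg: "{((x, H15_z), (x, C (x, y) H7_w)), ((x, C (x, y) H7_w), (x, C (x, y) H7_d)),
              ((x, C (x, y) H7_d), (x, C (x, y) H7_u)), ((x, C (x, y) H7_w), (x, H15_z)),
              ((x, C (x, y) H7_d), (x, C (x, y) H7_w)), ((x, C (x, y) H7_u), (x, C (x, y) H7_d))}
      \<subseteq> parcs \<Gamma>" if "(x, y) \<in> TC_outer" for x y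
    using parcs_H15_leg[of "C (x, y)"] C[OF that] that by (auto intro!: inner simp: TC_outer_iff)
  have outer: "((x, C (x, y) H7_u), (y, C (y, x) H7_u)) \<in> parcs \<Gamma>"
    if "(x, y) \<in> TC_outer" for x y
  proof -
    have "(y, x) \<in> TC_outer" using that by (auto simp: TC_outer_iff)
    then show ?thesis
      using that C[of "(x, y)"] C[of "(y, x)"] by (force simp: \<Gamma> replace_by_H15_def TC_def)
  qed
  have chord: "((x, H15_z), (y, H15_z)) \<in> parcs \<Gamma>" if "(x, y) \<in> TC_chords" for x y
  proof -
    have "\<phi> (x, y) = H15_z" "\<phi> (y, x) = H15_z"
      using \<phi>(2) that TC_chord_props(5)[OF that] by (auto simp: H15_u_def)
    then show ?thesis
      using that by (force simp: \<Gamma> replace_by_H15_def TC_def)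
  qed
  have "distinct xs"
    using C_neq[of "(17, 18)"] C_neq[of "(18, 17)"] C_neq[of "(5, 6)"] C_neq[of "(6, 5)"]
      C_neq[of "(23, 22)"] C_neq[of "(22, 23)"] C_neq[of "(1, 0)"] C_neq[of "(0, 1)"]
      TC_outer_TC_cycle
    unfolding xs_def seg_def by auto
  moreover have "hd xs \<in> pverts \<Gamma>"
    by (simp add: xs_def seg_def \<Gamma> replace_by_H15_def TC_def H15_def)
  \<comment> \<open>Arcs inside a segment come from \<open>leg\<close>, those between the two halves
    of a step from \<open>outer\<close>, and those between steps from \<open>chord\<close>; the
    chord from 0 to 17 closes the cycle.\<close>
  moreover have "set (cyclic_arcs xs) \<subseteq> parcs \<Gamma>"
    using TC_outer_TC_cycle TC_chords_TC_cycle
      leg[of 17 18] leg[of 18 17] leg[of 5 6] leg[of 6 5]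
      leg[of 23 22] leg[of 22 23] leg[of 1 0] leg[of 0 1]
      outer[of 17 18] outer[of 5 6] outer[of 23 22] outer[of 1 0]
      chord[of 18 5] chord[of 6 23] chord[of 22 1] chord[of 0 17]
    unfolding xs_def seg_def cyclic_arcs_def by simp
  moreover have "length (cyclic_arcs xs) = 32" "xs \<noteq> []"
    by (simp_all add: xs_def seg_def cyclic_arcs_def)
  ultimately show ?thesis
    using cycle_cyclic_arcs by blast
qed

theorem proposition4p1:
  shows "pre_digraph.cycle (with_proj TC) (cyclic_arcs [0, 17, 18, 5, 6, 23, 22, 1]) \<and>
         alternates_cyclically TC_chords TC_outer (cyclic_arcs [0, 17, 18, 5, 6, 23, 22, 1]) \<and>
         (\<forall>\<Gamma>. is_G450 \<Gamma> \<longrightarrow> (\<exists>p. pre_digraph.cycle (with_proj \<Gamma>) p \<and> length p = 32))"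
  using cycle_TC_cycle alternates_TC_cycle cycle_32_G450 by blast

end
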